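(* Let $X$ be a two-dimensional real normed space with unit ball $BX$, and let $S\subset X$ be a well-distributed set. (i) Assume that $$\liminf_{N\to\infty}|\Delta_{X,N}(S)|\,N^{-3/2}=0.$$ Then the one-dimensional Hausdorff measure of $\mathrm{Ext}(BX)$ is $0$. (ii) If moreover $$|\Delta_{X,N}(S)|=O(N^{1+\alpha})\quad (N\to\infty)$$ for some $\alpha\in(0,1/2)$, then the Hausdorff dimension of $\mathrm{Ext}(BX)$ is at most $2\alpha$.
   Context: $X$ denotes $\mathbb{R}^2$ equipped with a norm $\|\cdot\|_X$, and $BX=\{x:\|x\|_X\le 1\}$. A set $S\subset X$ is well-distributed if there is a constant $K$ such that for every $x\in X$ there is $y\in S$ with $\|x-y\|_X\le K$. For a positive integer $N$ and $A\subset X$, $\Delta_{X,N}(A)$ is the set of all numbers $\|a-a'\|_X$ with $a,a'\in A$ and $\|a-a'\|_X\le N$; $|\cdot|$ denotes cardinality (possibly $\infty$), and $N$ runs over positive integers. For a convex set $A$, $\mathrm{Ext}(A)$ is the set of extremal points of $A$: $x\in\mathrm{Ext}(A)$ iff $x\in A$ and for any segment $[y,z]$, $x\in[y,z]\subset A$ implies $x=y$ or $x=z$. Hausdorff measure and dimension are taken with respect to the metric of $X$ (equivalently, the Euclidean metric). *)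

theory Defs
  imports "HOL-Analysis.Analysis"
begin

definition is_norm :: "('a::real_vector \<Rightarrow> real) \<Rightarrow> bool" where
  "is_norm nrm \<longleftrightarrow>
     (\<forall>x. 0 \<le> nrm x) \<and>
     (\<forall>x. nrm x = 0 \<longleftrightarrow> x = 0) \<and>
     (\<forall>c x. nrm (c *\<^sub>R x) = \<bar>c\<bar> * nrm x) \<and>
     (\<forall>x y. nrm (x + y) \<le> nrm x + nrm y)"

definition unit_ball :: "('a::real_vector \<Rightarrow> real) \<Rightarrow> 'a set" where
  "unit_ball nrm = {x. nrm x \<le> 1}"

definition well_distributed :: "('a::real_vector \<Rightarrow> real) \<Rightarrow> 'a set \<Rightarrow> bool" where
  "well_distributed nrm S \<longleftrightarrow> (\<exists>K. \<forall>x. \<exists>y\<in>S. nrm (x - y) \<le> K)"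

definition distance_set :: "('a::real_vector \<Rightarrow> real) \<Rightarrow> nat \<Rightarrow> 'a set \<Rightarrow> real set" where
  "distance_set nrm N A =
     {nrm (a - a') | a a'. a \<in> A \<and> a' \<in> A \<and> nrm (a - a') \<le> real N}"

text \<open>
  Hausdorff measure and dimension are defined relative to an explicit metric \<open>d\<close>, because
  the metric induced by an arbitrary norm is not the one of the type class.
\<close>

definition ediam :: "('a \<Rightarrow> 'a \<Rightarrow> real) \<Rightarrow> 'a set \<Rightarrow> ennreal" where
  "ediam d U = (SUP x\<in>U. SUP y\<in>U. ennreal (d x y))"

text \<open>
  The value \<open>diam U ^ s\<close> of a covering set, with the usual conventions \<open>0 ^ 0 = 1\<close> for
  nonempty \<open>U\<close> (whereas \<open>0 powr 0 = 0\<close>) and value \<open>0\<close> for the empty set. It is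
  only used for sets of finite diameter, for which \<open>enn2real\<close> loses nothing.
\<close>

definition diam_pow :: "('a \<Rightarrow> 'a \<Rightarrow> real) \<Rightarrow> real \<Rightarrow> 'a set \<Rightarrow> ennreal" where
  "diam_pow d s U =
     (if U = {} then 0
      else if s = 0 then 1
      else ennreal (enn2real (ediam d U) powr s))"

definition hausdorff_content ::
    "('a \<Rightarrow> 'a \<Rightarrow> real) \<Rightarrow> real \<Rightarrow> real \<Rightarrow> 'a set \<Rightarrow> ennreal" where
  "hausdorff_content d s \<delta> A =
     (INF U\<in>{U :: nat \<Rightarrow> 'a set. A \<subseteq> (\<Union>n. U n) \<and> (\<forall>n. ediam d (U n) \<le> ennreal \<delta>)}.
        \<Sum>n. diam_pow d s (U n))"

definition hausdorff_measure ::
    "('a \<Rightarrow> 'a \<Rightarrow> real) \<Rightarrow> real \<Rightarrow> 'a set \<Rightarrow> ennreal" where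
  "hausdorff_measure d s A = (SUP \<delta>\<in>{0<..}. hausdorff_content d s \<delta> A)"

definition hausdorff_dim :: "('a \<Rightarrow> 'a \<Rightarrow> real) \<Rightarrow> 'a set \<Rightarrow> ereal" where
  "hausdorff_dim d A = (INF s\<in>{s. 0 \<le> s \<and> hausdorff_measure d s A = 0}. ereal s)"

end

theory Submission
  imports Defs
begin

text \<open>
  Fix distinct \<open>P\<close>, \<open>Q\<close> in \<open>S\<close>. For an extreme point \<open>e\<close> and a radius \<open>j\<close> of order \<open>N\<close>, pick a
  point of \<open>S\<close> at bounded distance from \<open>P + j e\<close>. Its distances to \<open>P\<close> and \<open>Q\<close> belong to the set
  \<open>D\<close> of distances that differ from \<open>j\<close> by at most a constant \<open>H\<close>. If several such points share both
  distances, they lie on the intersection of two spheres of the norm, which in the plane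
  consists of at most two segments (up to finitely many points). The directions of these
  points approximate the \<open>e\<close> up to \<open>O(1 / N)\<close>, and no extreme point lies inside a segment of the
  unit sphere. Hence a family of extreme points whose mutual distances exceed \<open>C / N\<close> has at most
  \<open>O(card D ^ 2)\<close> members. Letting \<open>j\<close> run through about \<open>N\<close> separated radii makes the sets \<open>D\<close>
  disjoint, so one of them has size \<open>O(card (distance_set N) / N)\<close>. The extreme points are
  therefore covered by \<open>O((card (distance_set N) / N) ^ 2)\<close> sets of diameter \<open>O(1 / N)\<close>.
\<close>

text \<open>A value of \<open>f\<close> on \<open>G\<close> other than the minimum and the maximum
  would be the middle of a chain.\<close>

lemma card_le_2_if_no_chain:
  fixes f :: "'a \<Rightarrow> real"
  assumes "finite G" "inj_on f G"
    and "\<And>x y z. x \<in> G \<Longrightarrow> y \<in> G \<Longrightarrow> z \<in> G \<Longrightarrow> f x < f y \<Longrightarrow> f y < f z \<Longrightarrow> False"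
  shows "card G \<le> 2"
proof (rule ccontr)
  assume "\<not> card G \<le> 2"
  then have c: "card (f ` G) > 2" using card_image[OF assms(2)] by simp
  define A where "A = f ` G"
  have A: "finite A" "A \<noteq> {}" using assms(1) c by (auto simp: A_def)
  have "card {Min A, Max A} \<le> 2" by (simp add: card_insert_if)
  then have "\<not> A \<subseteq> {Min A, Max A}" using c card_mono[of "{Min A, Max A}" A] by (auto simp: A_def)
  then obtain b where b: "b \<in> A" "b \<noteq> Min A" "b \<noteq> Max A" by blast
  then have "Min A < b" "b < Max A" using A by (simp_all add: order_less_le)
  moreover have "Min A \<in> f ` G" "Max A \<in> f ` G" "b \<in> f ` G"
    using A b Min_in Max_in by (simp_all add: A_def)
  ultimately show False using assms(3) by auto
qed

section \<open>Norms on the plane and their extreme points\<close>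

locale planar_norm =
  fixes nrm :: "real ^ 2 \<Rightarrow> real"
  assumes is_norm: "is_norm nrm"
begin

lemma nrm_nonneg [simp]: "0 \<le> nrm x"
  and nrm_eq_0 [simp]: "nrm x = 0 \<longleftrightarrow> x = 0"
  and nrm_scaleR [simp]: "nrm (c *\<^sub>R x) = \<bar>c\<bar> * nrm x"
  and nrm_triangle: "nrm (x + y) \<le> nrm x + nrm y"
  using is_norm by (auto simp: is_norm_def)

lemma nrm_0 [simp]: "nrm 0 = 0"
  using nrm_eq_0[of 0] by blast

lemma nrm_minus [simp]: "nrm (- x) = nrm x"
  using nrm_scaleR[of "-1" x] by simp

lemma nrm_minus_commute: "nrm (x - y) = nrm (y - x)"
  using nrm_minus[of "x - y"] by simp

lemma nrm_triangle_sub: "nrm (x - y) \<le> nrm x + nrm y"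
  using nrm_triangle[of x "- y"] by simp

lemma nrm_diff_bound: "\<bar>nrm x - nrm y\<bar> \<le> nrm (x - y)"
  using nrm_triangle[of "x - y" y] nrm_triangle[of "y - x" x] nrm_minus_commute[of x y] by simp

lemma nrm_pos: "x \<noteq> 0 \<Longrightarrow> 0 < nrm x"
  using nrm_nonneg[of x] nrm_eq_0[of x] by linarith

text \<open>Scaling \<open>x\<close> by \<open>1 / j\<close> gives a vector within
  \<open>H / j\<close> of \<open>e\<close>. Scaling by \<open>1 / nrm x\<close> instead adds at most
  another \<open>H / j\<close>, because \<open>nrm x\<close> differs from \<open>j\<close> by at
  most \<open>H\<close>.\<close>

lemma normalize_close:
  assumes "nrm e = 1" "0 < j" "nrm (x - j *\<^sub>R e) \<le> H" "x \<noteq> 0"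
  shows "nrm ((1 / nrm x) *\<^sub>R x - e) \<le> 2 * H / j"
proof -
  have r: "0 < nrm x" using assms nrm_pos by simp
  have "\<bar>nrm x - j\<bar> \<le> H"
    using nrm_diff_bound[of x "j *\<^sub>R e"] assms by simp
  have "(1 / nrm x) *\<^sub>R x - e = (1 / nrm x - 1 / j) *\<^sub>R x + (1 / j) *\<^sub>R (x - j *\<^sub>R e)"
    using assms by (simp add: algebra_simps)
  then have "nrm ((1 / nrm x) *\<^sub>R x - e) \<le> \<bar>1 / nrm x - 1 / j\<bar> * nrm x + (1 / j) * nrm (x - j *\<^sub>R e)"
    using nrm_triangle[of "(1 / nrm x - 1 / j) *\<^sub>R x" "(1 / j) *\<^sub>R (x - j *\<^sub>R e)"] assms by simp
  also have "\<bar>1 / nrm x - 1 / j\<bar> * nrm x = \<bar>(1 / nrm x - 1 / j) * nrm x\<bar>"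
    by (simp add: abs_mult)
  also have "(1 / nrm x - 1 / j) * nrm x = (j - nrm x) / j"
    using r assms by (simp add: field_simps)
  also have "\<bar>(j - nrm x) / j\<bar> + (1 / j) * nrm (x - j *\<^sub>R e) \<le> H / j + (1 / j) * H"
    using assms \<open>\<bar>nrm x - j\<bar> \<le> H\<close> by (intro add_mono mult_left_mono) (auto simp: divide_right_mono abs_minus_commute)
  finally show ?thesis by simp
qed

lemma nrm_le_norm: "\<exists>M>0. \<forall>x. nrm x \<le> M * norm x"
proof -
  let ?M = "(\<Sum>i\<in>Basis. nrm i) + 1"
  have "nrm x \<le> ?M * norm x" for x
  proof -
    have sub: "nrm (\<Sum>i\<in>A. f i) \<le> (\<Sum>i\<in>A. nrm (f i))" if "finite A" for A and f :: "real^2 \<Rightarrow> real^2"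
      using that
    proof (induction A rule: finite_induct)
      case empty
      then show ?case by simp
    next
      case (insert a A)
      then show ?case using nrm_triangle[of "f a" "\<Sum>i\<in>A. f i"] by auto
    qed
    have "nrm x = nrm (\<Sum>i\<in>Basis. (x \<bullet> i) *\<^sub>R i)" by (simp add: euclidean_representation)
    also have "\<dots> \<le> (\<Sum>i\<in>Basis. nrm ((x \<bullet> i) *\<^sub>R i))" by (rule sub) simp
    also have "\<dots> \<le> (\<Sum>i\<in>Basis. norm x * nrm i)"
      by (intro sum_mono) (auto intro!: mult_right_mono Basis_le_norm)
    also have "\<dots> \<le> ?M * norm x" by (simp add: sum_distrib_left algebra_simps)
    finally show ?thesis .
  qed
  moreover have "?M > 0" by (simp add: add_nonneg_pos sum_nonneg)
  ultimately show ?thesis by blast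
qed

lemma continuous_on_nrm: "continuous_on A nrm"
proof -
  obtain M where M: "M > 0" "\<And>x. nrm x \<le> M * norm x" using nrm_le_norm by blast
  have "dist (nrm x) (nrm y) \<le> M * dist x y" for x y
    using nrm_diff_bound[of x y] M(2)[of "x - y"] by (simp add: dist_norm)
  then have "M-lipschitz_on A nrm" using M by (intro lipschitz_onI) auto
  then show ?thesis by (rule lipschitz_on_continuous_on)
qed

text \<open>By compactness \<open>nrm\<close> attains a positive minimum on the Euclidean unit
  sphere; homogeneity extends the comparison to all vectors.\<close>

lemma norm_le_nrm: "\<exists>M>0. \<forall>x. norm x \<le> M * nrm x"
proof -
  have "\<exists>b\<in>sphere (0::real^2) 1. \<forall>y\<in>sphere 0 1. nrm b \<le> nrm y"
    by (rule continuous_attains_inf) (auto simp: continuous_on_nrm)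
  then obtain b where b: "norm b = 1" "\<And>y. norm y = 1 \<Longrightarrow> nrm b \<le> nrm y" by auto
  have "b \<noteq> 0" using b by auto
  then have "0 < nrm b" by (rule nrm_pos)
  moreover have "norm x \<le> (1 / nrm b) * nrm x" for x
  proof (cases "x = 0")
    case False
    have "nrm b \<le> nrm ((1 / norm x) *\<^sub>R x)" by (rule b) (use False in simp)
    then show ?thesis using False \<open>0 < nrm b\<close> by (simp add: field_simps)
  qed simp
  ultimately show ?thesis by (intro exI[of _ "1 / nrm b"]) auto
qed

lemma compact_unit_sphere: "compact {x. nrm x = 1}"
proof -
  obtain M where M: "\<And>x. norm x \<le> M * nrm x" using norm_le_nrm by blast
  have "bounded {x. nrm x = 1}" using M by (intro boundedI[of _ M]) (metis mem_Collect_eq mult.right_neutral)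
  moreover have "closed {x. nrm x = 1}"
    using continuous_closed_preimage_constant[OF continuous_on_nrm closed_UNIV, of 1] by simp
  ultimately show ?thesis by (simp add: compact_eq_bounded_closed)
qed

text \<open>A point with \<open>nrm x < 1\<close> can be moved by \<open>1 - nrm x\<close> both ways
  along a line without leaving the ball, so it is the midpoint of a nondegenerate segment
  there.\<close>

lemma extreme_point_nrm_eq_1:
  assumes "x extreme_point_of unit_ball nrm"
  shows "nrm x = 1"
proof (rule ccontr)
  assume "nrm x \<noteq> 1"
  then have lt: "nrm x < 1" using assms by (auto simp: extreme_point_of_def unit_ball_def)
  define y :: "real^2" where "y = (if x = 0 then axis 1 1 else x)"
  have "y \<noteq> 0" by (simp add: y_def axis_eq_0_iff)
  then have y: "0 < nrm y" by (rule nrm_pos)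
  define t where "t = (1 - nrm x) / nrm y"
  have t: "t > 0" using lt y by (simp add: t_def)
  have "nrm (t *\<^sub>R y) = 1 - nrm x" using lt \<open>y \<noteq> 0\<close> by (simp add: t_def)
  then have "nrm (x + t *\<^sub>R y) \<le> 1" "nrm (x - t *\<^sub>R y) \<le> 1"
    using nrm_triangle[of x "t *\<^sub>R y"] nrm_triangle_sub[of x "t *\<^sub>R y"] by linarith+
  moreover have "x \<in> open_segment (x + t *\<^sub>R y) (x - t *\<^sub>R y)"
  proof -
    have "nrm ((x + t *\<^sub>R y) - (x - t *\<^sub>R y)) = nrm ((2 * t) *\<^sub>R y)"
      by (simp add: algebra_simps flip: scaleR_add_left)
    also have "\<dots> > 0" using t \<open>y \<noteq> 0\<close> by (intro nrm_pos) simp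
    finally have "x + t *\<^sub>R y \<noteq> x - t *\<^sub>R y" by auto
    moreover have "x = (1 - 1/2) *\<^sub>R (x + t *\<^sub>R y) + (1/2) *\<^sub>R (x - t *\<^sub>R y)"
      by (simp add: algebra_simps flip: scaleR_add_left)
    ultimately show ?thesis unfolding in_segment by (metis half_gt_zero_iff field_sum_of_halves less_add_same_cancel1 zero_less_one)
  qed
  ultimately show False using assms by (auto simp: extreme_point_of_def unit_ball_def)
qed

section \<open>Covers by few small sets\<close>

text \<open>The bound \<open>m\<close> is real so that asymptotic estimates can be inserted without
  rounding.\<close>

definition small_cover :: "(real ^ 2) set \<Rightarrow> real \<Rightarrow> real \<Rightarrow> bool" where
  "small_cover A \<eta> m \<longleftrightarrow> (\<exists>\<U>. finite \<U> \<and> real (card \<U>) \<le> m \<and> A \<subseteq> \<Union>\<U> \<and>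
     (\<forall>U\<in>\<U>. \<forall>x\<in>U. \<forall>y\<in>U. nrm (x - y) \<le> \<eta>))"

lemma small_cover_mono:
  assumes "small_cover A \<eta> m" "B \<subseteq> A" "\<eta> \<le> \<eta>'" "m \<le> m'"
  shows "small_cover B \<eta>' m'"
proof -
  obtain \<U> where "finite \<U>" "real (card \<U>) \<le> m" "A \<subseteq> \<Union>\<U>" "\<forall>U\<in>\<U>. \<forall>x\<in>U. \<forall>y\<in>U. nrm (x - y) \<le> \<eta>"
    using assms(1) unfolding small_cover_def by blast
  moreover have "\<forall>U\<in>\<U>. \<forall>x\<in>U. \<forall>y\<in>U. nrm (x - y) \<le> \<eta>'"
    using calculation(4) assms(3) by fastforce
  ultimately show ?thesis unfolding small_cover_def
    using assms(2,4) by (intro exI[of _ \<U>] conjI) (assumption | simp | blast)+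
qed

lemma small_cover_Un:
  assumes "small_cover A \<eta> m" "small_cover B \<eta> m'"
  shows "small_cover (A \<union> B) \<eta> (m + m')"
proof -
  obtain \<U> where U: "finite \<U>" "real (card \<U>) \<le> m" "A \<subseteq> \<Union>\<U>" "\<forall>U\<in>\<U>. \<forall>x\<in>U. \<forall>y\<in>U. nrm (x - y) \<le> \<eta>"
    using assms(1) unfolding small_cover_def by blast
  obtain \<V> where V: "finite \<V>" "real (card \<V>) \<le> m'" "B \<subseteq> \<Union>\<V>" "\<forall>U\<in>\<V>. \<forall>x\<in>U. \<forall>y\<in>U. nrm (x - y) \<le> \<eta>"
    using assms(2) unfolding small_cover_def by blast
  have "real (card (\<U> \<union> \<V>)) \<le> m + m'" using card_Un_le[of \<U> \<V>] U(2) V(2) by linarith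
  then show ?thesis unfolding small_cover_def
    using U V by (intro exI[of _ "\<U> \<union> \<V>"]) auto
qed

text \<open>A discrete form of the final estimate, required for all large \<open>N\<close> and hence
  stable under finite unions. Infinite distance sets are exempted for each \<open>N\<close>
  separately, because the liminf hypothesis yields finiteness only for infinitely many
  \<open>N\<close>.\<close>

definition roughly_covered :: "(real ^ 2) set \<Rightarrow> (real ^ 2) set \<Rightarrow> bool" where
  "roughly_covered S A \<longleftrightarrow> (\<exists>C>0. \<forall>\<^sub>F N in sequentially. finite (distance_set nrm N S) \<longrightarrow>
     small_cover A (C / real N) (C * (real (card (distance_set nrm N S)) / real N)\<^sup>2))"

lemma roughly_covered_empty: "roughly_covered S {}"
  unfolding roughly_covered_def small_cover_def
  by (intro exI[of _ 1] conjI always_eventually allI impI exI[of _ "{}"]) simp_all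

lemma roughly_covered_subset: "roughly_covered S A \<Longrightarrow> B \<subseteq> A \<Longrightarrow> roughly_covered S B"
  unfolding roughly_covered_def
  using small_cover_mono[OF _ _ order_refl order_refl] by (blast intro: eventually_mono)

lemma roughly_covered_Un:
  assumes "roughly_covered S A" "roughly_covered S B"
  shows "roughly_covered S (A \<union> B)"
proof -
  let ?c = "\<lambda>N. (real (card (distance_set nrm N S)) / real N)\<^sup>2"
  obtain C where C: "0 < C" "\<forall>\<^sub>F N in sequentially. finite (distance_set nrm N S) \<longrightarrow>
      small_cover A (C / real N) (C * ?c N)"
    using assms(1) unfolding roughly_covered_def by blast
  obtain D where D: "0 < D" "\<forall>\<^sub>F N in sequentially. finite (distance_set nrm N S) \<longrightarrow>
      small_cover B (D / real N) (D * ?c N)"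
    using assms(2) unfolding roughly_covered_def by blast
  have "\<forall>\<^sub>F N in sequentially. finite (distance_set nrm N S) \<longrightarrow>
      small_cover (A \<union> B) ((C + D) / real N) ((C + D) * ?c N)"
    using C(2) D(2)
  proof eventually_elim
    case (elim N)
    show ?case
    proof
      assume fin: "finite (distance_set nrm N S)"
      have "C / real N \<le> (C + D) / real N" "D / real N \<le> (C + D) / real N"
        using C(1) D(1) by (simp_all add: divide_right_mono)
      then have "small_cover A ((C + D) / real N) (C * ?c N)" "small_cover B ((C + D) / real N) (D * ?c N)"
        using elim fin small_cover_mono by blast+
      then show "small_cover (A \<union> B) ((C + D) / real N) ((C + D) * ?c N)"
        unfolding distrib_right by (rule small_cover_Un)
    qed
  qed
  then show ?thesis unfolding roughly_covered_def using C(1) D(1) by (intro exI[of _ "C + D"]) auto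
qed

end

section \<open>The unit sphere as a concave graph over an arc\<close>

text \<open>
  Coordinates in which the unit sphere is locally the graph of a concave function: \<open>v \<bullet> x\<close> is
  the abscissa and \<open>w \<bullet> x\<close> the height of \<open>x\<close> with respect to the basis \<open>(q, p)\<close>.
\<close>

locale planar_frame = planar_norm +
  fixes p q v w :: "real ^ 2"
  assumes nrm_p: "nrm p = 1" and nrm_q: "nrm q = 1"
    and decomp: "x = (v \<bullet> x) *\<^sub>R q + (w \<bullet> x) *\<^sub>R p"
begin

text \<open>The bound \<open>1 / 2\<close> on the abscissa allows \<open>height_diff_le\<close> to
  absorb the term with the factor \<open>v \<bullet> a\<close>.\<close>

definition on_arc :: "real ^ 2 \<Rightarrow> bool" where
  "on_arc x \<longleftrightarrow> nrm x = 1 \<and> \<bar>v \<bullet> x\<bar> \<le> 1 / 2 \<and> 0 < w \<bullet> x"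

lemma frame_eqI: "v \<bullet> x = v \<bullet> y \<Longrightarrow> w \<bullet> x = w \<bullet> y \<Longrightarrow> x = y"
  by (metis decomp)

lemma nrm_le_coordinates: "nrm x \<le> \<bar>v \<bullet> x\<bar> + \<bar>w \<bullet> x\<bar>"
  using nrm_triangle[of "(v \<bullet> x) *\<^sub>R q" "(w \<bullet> x) *\<^sub>R p"] nrm_p nrm_q decomp[of x] by simp

lemma height_le: "\<bar>w \<bullet> x\<bar> \<le> nrm x + \<bar>v \<bullet> x\<bar>"
proof -
  have "(w \<bullet> x) *\<^sub>R p = x - (v \<bullet> x) *\<^sub>R q" using decomp[of x] by (simp add: algebra_simps)
  then have "\<bar>w \<bullet> x\<bar> * nrm p \<le> nrm x + \<bar>v \<bullet> x\<bar> * nrm q"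
    using nrm_triangle_sub[of x "(v \<bullet> x) *\<^sub>R q"] nrm_scaleR[of "w \<bullet> x" p] by simp
  then show ?thesis using nrm_p nrm_q by simp
qed

text \<open>
  If \<open>b\<close> lies higher than \<open>a\<close>, then \<open>a - (w a / w b) b\<close> is a multiple of \<open>q\<close>, and \<open>nrm a = 1\<close>
  forces this multiple to be large.
\<close>

lemma height_diff_le:
  assumes a: "on_arc a" and b: "nrm b \<le> 1" "0 < w \<bullet> b"
  shows "w \<bullet> b - w \<bullet> a \<le> 3 * \<bar>v \<bullet> a - v \<bullet> b\<bar>"
proof (cases "w \<bullet> b \<le> w \<bullet> a")
  case False
  define l where "l = (w \<bullet> a) / (w \<bullet> b)"
  have l: "0 < l" "l < 1" using a b False by (auto simp: l_def on_arc_def)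
  have la: "w \<bullet> (a - l *\<^sub>R b) = 0" using b by (simp add: l_def inner_diff_right)
  have "nrm a \<le> nrm (l *\<^sub>R b) + nrm (a - l *\<^sub>R b)"
    using nrm_triangle[of "l *\<^sub>R b" "a - l *\<^sub>R b"] by simp
  also have "\<dots> \<le> l * 1 + \<bar>v \<bullet> (a - l *\<^sub>R b)\<bar>"
    using l b nrm_le_coordinates[of "a - l *\<^sub>R b"] la by (intro add_mono) auto
  finally have "1 - l \<le> \<bar>v \<bullet> a - l * (v \<bullet> b)\<bar>"
    using a by (simp add: on_arc_def inner_diff_right)
  then have "(1 - l) * (w \<bullet> b) \<le> \<bar>v \<bullet> a - l * (v \<bullet> b)\<bar> * (w \<bullet> b)"
    using b by (intro mult_right_mono) auto
  also have "\<dots> = \<bar>(v \<bullet> a - l * (v \<bullet> b)) * (w \<bullet> b)\<bar>"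
    using b by (simp add: abs_mult)
  \<comment> \<open>After multiplication by \<open>w \<bullet> b\<close>, which clears the
    denominator of \<open>l\<close>, the first summand is at most half of the height difference and
    moves to the left side. The second is at most 3/2 times the horizontal distance, whence the
    factor 3.\<close>
  also have "(v \<bullet> a - l * (v \<bullet> b)) * (w \<bullet> b)
      = (v \<bullet> a) * (w \<bullet> b - w \<bullet> a) + (w \<bullet> a) * (v \<bullet> a - v \<bullet> b)"
    using b by (simp add: l_def field_simps)
  also have "\<bar>\<dots>\<bar> \<le> (1/2) * (w \<bullet> b - w \<bullet> a) + (w \<bullet> a) * \<bar>v \<bullet> a - v \<bullet> b\<bar>"
  proof -
    have "\<bar>(v \<bullet> a) * (w \<bullet> b - w \<bullet> a)\<bar> \<le> (1/2) * (w \<bullet> b - w \<bullet> a)"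
      using a False by (auto simp: abs_mult on_arc_def intro!: mult_right_mono)
    moreover have "\<bar>(w \<bullet> a) * (v \<bullet> a - v \<bullet> b)\<bar> = (w \<bullet> a) * \<bar>v \<bullet> a - v \<bullet> b\<bar>"
      using a by (simp add: abs_mult on_arc_def)
    ultimately show ?thesis by linarith
  qed
  also have "(w \<bullet> a) * \<bar>v \<bullet> a - v \<bullet> b\<bar> \<le> (3/2) * \<bar>v \<bullet> a - v \<bullet> b\<bar>"
    using height_le[of a] a by (intro mult_right_mono) (auto simp: on_arc_def)
  also have "(1 - l) * (w \<bullet> b) = w \<bullet> b - w \<bullet> a"
    using b by (simp add: l_def field_simps)
  finally show ?thesis by (simp add: field_simps)
next
  case True
  then have "w \<bullet> b - w \<bullet> a \<le> 0" by simp
  also have "0 \<le> 3 * \<bar>v \<bullet> a - v \<bullet> b\<bar>" by simp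
  finally show ?thesis .
qed

text \<open>\<open>height_diff_le\<close> in both directions makes the height 3-Lipschitz in the
  abscissa; the abscissa itself contributes one more.\<close>

lemma on_arc_lipschitz:
  assumes "on_arc a" "on_arc b"
  shows "nrm (a - b) \<le> 4 * \<bar>v \<bullet> a - v \<bullet> b\<bar>"
proof -
  have "w \<bullet> b - w \<bullet> a \<le> 3 * \<bar>v \<bullet> a - v \<bullet> b\<bar>" "w \<bullet> a - w \<bullet> b \<le> 3 * \<bar>v \<bullet> b - v \<bullet> a\<bar>"
    using assms by (auto intro!: height_diff_le simp: on_arc_def)
  then show ?thesis using nrm_le_coordinates[of "a - b"] unfolding inner_diff_right by (smt (verit))
qed

text \<open>The chord from \<open>x\<close> to \<open>z\<close> has a point \<open>m\<close> with
  the abscissa of \<open>y\<close>. It lies in the ball, so \<open>height_diff_le\<close> puts it no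
  higher than \<open>y\<close>. The resulting inequality is stated with denominators
  cleared.\<close>

lemma on_arc_concave:
  assumes "on_arc x" "on_arc y" "on_arc z" "v \<bullet> x < v \<bullet> y" "v \<bullet> y < v \<bullet> z"
  shows "(w \<bullet> x) * (v \<bullet> z - v \<bullet> y) + (w \<bullet> z) * (v \<bullet> y - v \<bullet> x) \<le> (w \<bullet> y) * (v \<bullet> z - v \<bullet> x)"
proof -
  define t where "t = (v \<bullet> y - v \<bullet> x) / (v \<bullet> z - v \<bullet> x)"
  have t: "0 < t" "t < 1" using assms by (auto simp: t_def)
  define m where "m = (1 - t) *\<^sub>R x + t *\<^sub>R z"
  have "nrm m \<le> (1 - t) * nrm x + t * nrm z"
    unfolding m_def using nrm_triangle[of "(1 - t) *\<^sub>R x" "t *\<^sub>R z"] t by simp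
  then have "nrm m \<le> 1" using assms by (simp add: on_arc_def)
  have wm: "w \<bullet> m = (1 - t) * (w \<bullet> x) + t * (w \<bullet> z)" by (simp add: m_def inner_add_right)
  have "v \<bullet> m = v \<bullet> x + t * (v \<bullet> z - v \<bullet> x)"
    by (simp add: m_def inner_add_right algebra_simps)
  also have "\<dots> = v \<bullet> y" using assms by (simp add: t_def)
  finally have vm: "v \<bullet> m = v \<bullet> y" .
  have "0 < w \<bullet> m" unfolding wm using t assms by (auto intro!: add_pos_pos simp: on_arc_def)
  from height_diff_le[OF assms(2) \<open>nrm m \<le> 1\<close> this] have "w \<bullet> m \<le> w \<bullet> y" using vm by simp
  then have "(w \<bullet> m) * (v \<bullet> z - v \<bullet> x) \<le> (w \<bullet> y) * (v \<bullet> z - v \<bullet> x)"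
    using assms by (intro mult_right_mono) auto
  also have "(w \<bullet> m) * (v \<bullet> z - v \<bullet> x)
     = (w \<bullet> x) * (v \<bullet> z - v \<bullet> x) + (w \<bullet> z - w \<bullet> x) * (t * (v \<bullet> z - v \<bullet> x))"
    by (simp add: wm algebra_simps)
  also have "t * (v \<bullet> z - v \<bullet> x) = v \<bullet> y - v \<bullet> x" using assms by (simp add: t_def)
  finally show ?thesis by (simp add: algebra_simps)
qed

text \<open>
  Two parallel chords of a concave graph, one shifted horizontally against the other, lie on the
  same line, so the graph is affine between them.
\<close>

lemma parallel_chords_not_extreme:
  assumes arc: "on_arc a" "on_arc b" "on_arc a'" "on_arc b'" "on_arc e"
    and e: "v \<bullet> a < v \<bullet> e" "v \<bullet> e < v \<bullet> b"
    and par: "b' - a' = k *\<^sub>R (b - a)" "0 < k"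
    and shift: "v \<bullet> a < v \<bullet> a' \<and> v \<bullet> b < v \<bullet> b' \<or> v \<bullet> a' < v \<bullet> a \<and> v \<bullet> b' < v \<bullet> b"
  shows "\<not> e extreme_point_of unit_ball nrm"
proof
  assume ext: "e extreme_point_of unit_ball nrm"
  \<comment> \<open>Subtracting the line of slope \<sigma> makes both chords horizontal for
    \<open>h\<close> and preserves concavity.\<close>
  define \<sigma> where "\<sigma> = (w \<bullet> b - w \<bullet> a) / (v \<bullet> b - v \<bullet> a)"
  define h where "h x = w \<bullet> x - \<sigma> * (v \<bullet> x)" for x
  have ab: "v \<bullet> a < v \<bullet> b" using e by simp
  have slope: "w \<bullet> b - w \<bullet> a = \<sigma> * (v \<bullet> b - v \<bullet> a)" using ab by (simp add: \<sigma>_def)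
  have v': "v \<bullet> b' - v \<bullet> a' = k * (v \<bullet> b - v \<bullet> a)"
    using arg_cong[OF par(1), of "\<lambda>x. v \<bullet> x"] by (simp add: inner_diff_right)
  have w': "w \<bullet> b' - w \<bullet> a' = k * (w \<bullet> b - w \<bullet> a)"
    using arg_cong[OF par(1), of "\<lambda>x. w \<bullet> x"] by (simp add: inner_diff_right)
  have ab': "v \<bullet> a' < v \<bullet> b'" using v' ab par(2) by (metis diff_gt_0_iff_gt mult_pos_pos)
  have hab: "h b = h a" using slope by (simp add: h_def algebra_simps)
  have "w \<bullet> b' - w \<bullet> a' = \<sigma> * (v \<bullet> b' - v \<bullet> a')" by (simp add: w' v' slope)
  then have hab': "h b' = h a'" by (simp add: h_def algebra_simps)
  have conc: "h x * (v \<bullet> z - v \<bullet> y) + h z * (v \<bullet> y - v \<bullet> x) \<le> h y * (v \<bullet> z - v \<bullet> x)"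
    if "on_arc x" "on_arc y" "on_arc z" "v \<bullet> x < v \<bullet> y" "v \<bullet> y < v \<bullet> z" for x y z
    using on_arc_concave[OF that] by (simp add: h_def algebra_simps)
  \<comment> \<open>Once a concave function takes the same value at two points, it is nowhere larger
    outside the interval between them.\<close>
  have left: "h z \<le> h y" if "on_arc x" "on_arc y" "on_arc z" "v \<bullet> x < v \<bullet> y" "v \<bullet> y < v \<bullet> z" "h x = h y" for x y z
  proof -
    have "h z * (v \<bullet> y - v \<bullet> x) \<le> h y * (v \<bullet> y - v \<bullet> x)"
      using conc[OF that(1-5)] that(6) by (simp add: algebra_simps)
    then show ?thesis using that(4) by simp
  qed
  have right: "h x \<le> h y" if "on_arc x" "on_arc y" "on_arc z" "v \<bullet> x < v \<bullet> y" "v \<bullet> y < v \<bullet> z" "h z = h y" for x y z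
  proof -
    have "h x * (v \<bullet> z - v \<bullet> y) \<le> h y * (v \<bullet> z - v \<bullet> y)"
      using conc[OF that(1-5)] that(6) by (simp add: algebra_simps)
    then show ?thesis using that(5) by simp
  qed
  have "h a * (v \<bullet> b - v \<bullet> e) + h a * (v \<bullet> e - v \<bullet> a) \<le> h e * (v \<bullet> b - v \<bullet> a)"
    using conc[OF arc(1,5,2) e] by (simp add: hab)
  then have "h a * (v \<bullet> b - v \<bullet> a) \<le> h e * (v \<bullet> b - v \<bullet> a)" by (simp add: algebra_simps)
  then have ge: "h a \<le> h e" using ab by simp
  \<comment> \<open>Because the end points are shifted the same way, each chord bounds the other
    from above, so both lie at the same level of \<open>h\<close>. Two points at this level on one
    side of \<open>e\<close> then bound \<open>h e\<close>.\<close>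
  have le: "h e \<le> h a" using shift
  proof
    assume sh: "v \<bullet> a < v \<bullet> a' \<and> v \<bullet> b < v \<bullet> b'"
    have "h b' \<le> h b" using left[of a b b'] arc sh ab hab by simp
    moreover have "h a \<le> h a'" using right[of a a' b'] arc sh ab' hab' by simp
    ultimately have "h b' = h b" using hab hab' by simp
    then show ?thesis using right[of e b b'] arc sh e hab by simp
  next
    assume sh: "v \<bullet> a' < v \<bullet> a \<and> v \<bullet> b' < v \<bullet> b"
    have "h a' \<le> h a" using right[of a' a b] arc sh ab hab by simp
    moreover have "h b \<le> h b'" using left[of a' b' b] arc sh ab' hab' by simp
    ultimately have "h a' = h a" using hab hab' by simp
    then show ?thesis using left[of a' a e] arc sh e hab by simp
  qed
  define t where "t = (v \<bullet> e - v \<bullet> a) / (v \<bullet> b - v \<bullet> a)"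
  have t: "0 < t" "t < 1" using e by (auto simp: t_def)
  have tt: "t * (v \<bullet> b - v \<bullet> a) = v \<bullet> e - v \<bullet> a" using ab by (simp add: t_def)
  have "e = (1 - t) *\<^sub>R a + t *\<^sub>R b"
  proof (rule frame_eqI)
    show "v \<bullet> e = v \<bullet> ((1 - t) *\<^sub>R a + t *\<^sub>R b)"
      using tt by (simp add: inner_add_right algebra_simps)
    have "w \<bullet> e - w \<bullet> a = \<sigma> * (v \<bullet> e - v \<bullet> a)"
      using ge le by (simp add: h_def algebra_simps)
    also have "\<dots> = t * (w \<bullet> b - w \<bullet> a)" by (simp add: slope flip: tt)
    finally show "w \<bullet> e = w \<bullet> ((1 - t) *\<^sub>R a + t *\<^sub>R b)"
      by (simp add: inner_add_right algebra_simps)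
  qed
  then have "e \<in> open_segment a b" using t ab by (auto simp: in_segment)
  then show False using ext arc(1,2) by (auto simp: extreme_point_of_def unit_ball_def on_arc_def)
qed

section \<open>Counting separated extreme points on one arc\<close>

lemma coordinates_bounded: "\<exists>M>0. \<forall>x. \<bar>v \<bullet> x\<bar> \<le> M * nrm x \<and> \<bar>w \<bullet> x\<bar> \<le> M * nrm x"
proof -
  obtain M where M: "M > 0" "\<And>x. norm x \<le> M * nrm x" using norm_le_nrm by blast
  have "\<bar>c \<bullet> x\<bar> \<le> ((norm v + norm w + 1) * M) * nrm x" if "norm c \<le> norm v + norm w" for c x
  proof -
    have "\<bar>c \<bullet> x\<bar> \<le> norm c * norm x" by (rule Cauchy_Schwarz_ineq2)
    also have "\<dots> \<le> (norm v + norm w + 1) * (M * nrm x)"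
      using that M by (intro mult_mono) auto
    finally show ?thesis by (simp add: mult.assoc)
  qed
  moreover have "(norm v + norm w + 1) * M > 0" using M by (simp add: add_nonneg_pos)
  ultimately show ?thesis by (metis add_increasing add_increasing2 norm_ge_zero order_refl)
qed

text \<open>
  The horizontal shift between the two normalisations of \<open>x e\<close> can be positive,
  negative or zero, which leaves room for at most two, two and one points, respectively.
\<close>

lemma card_two_spheres_le:
  assumes fin: "finite G"
    and ext: "\<And>e. e \<in> G \<Longrightarrow> e extreme_point_of unit_ball nrm" "\<And>e. e \<in> G \<Longrightarrow> on_arc e"
    and arc: "\<And>e. e \<in> G \<Longrightarrow> on_arc ((1 / r) *\<^sub>R x e)"
      "\<And>e. e \<in> G \<Longrightarrow> on_arc ((1 / r') *\<^sub>R (x e - u))"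
    and close: "\<And>e. e \<in> G \<Longrightarrow> \<bar>v \<bullet> ((1 / r) *\<^sub>R x e) - v \<bullet> e\<bar> \<le> \<eta>"
    and sep: "\<And>e f. e \<in> G \<Longrightarrow> f \<in> G \<Longrightarrow> e \<noteq> f \<Longrightarrow> 2 * \<eta> < \<bar>v \<bullet> e - v \<bullet> f\<bar>"
    and pos: "0 < r" "0 < r'" "u \<noteq> 0"
  shows "card G \<le> 5"
proof -
  define a where "a e = (1 / r) *\<^sub>R x e" for e
  define a' where "a' e = (1 / r') *\<^sub>R (x e - u)" for e
  have arc: "on_arc (a e)" "on_arc (a' e)" if "e \<in> G" for e
    using arc that by (auto simp: a_def a'_def)
  have close: "\<bar>v \<bullet> a e - v \<bullet> e\<bar> \<le> \<eta>" if "e \<in> G" for e using close that by (simp add: a_def)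
  have inj: "inj_on (\<lambda>e. v \<bullet> e) A" if "A \<subseteq> G" for A
  proof (rule inj_onI, rule ccontr)
    fix e f assume ef: "e \<in> A" "f \<in> A" "v \<bullet> e = v \<bullet> f" "e \<noteq> f"
    then have "e \<in> G" "f \<in> G" using that by auto
    then show False using sep[of e f] close[of e] ef by fastforce
  qed
  have chain: False if "e1 \<in> G" "e2 \<in> G" "e3 \<in> G" "v \<bullet> e1 < v \<bullet> e2" "v \<bullet> e2 < v \<bullet> e3"
    and "v \<bullet> a e1 < v \<bullet> a' e1 \<and> v \<bullet> a e3 < v \<bullet> a' e3 \<or> v \<bullet> a' e1 < v \<bullet> a e1 \<and> v \<bullet> a' e3 < v \<bullet> a e3"
    for e1 e2 e3
  proof -
    \<comment> \<open>Separation by more than 2 \<eta> survives the displacement by \<eta>, so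
      \<open>e2\<close> stays strictly between the end points of the chord. The translation by
      \<open>u\<close> cancels in differences, which makes the two chords parallel.\<close>
    have "v \<bullet> a e1 < v \<bullet> e2" "v \<bullet> e2 < v \<bullet> a e3"
      using sep[of e1 e2] sep[of e2 e3] close[of e1] close[of e3] close[of e2] that by fastforce+
    moreover have "a' e3 - a' e1 = (r / r') *\<^sub>R (a e3 - a e1)"
      using pos by (simp add: a_def a'_def algebra_simps)
    ultimately show False
      using parallel_chords_not_extreme[of "a e1" "a e3" "a' e1" "a' e3" e2 "r / r'"] that arc ext pos
      by simp
  qed
  have "card {e\<in>G. v \<bullet> a e < v \<bullet> a' e} \<le> 2"
    by (rule card_le_2_if_no_chain[OF _ inj]) (use fin chain in auto)
  moreover have "card {e\<in>G. v \<bullet> a' e < v \<bullet> a e} \<le> 2"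
    by (rule card_le_2_if_no_chain[OF _ inj]) (use fin chain in auto)
  moreover have "card {e\<in>G. v \<bullet> a' e = v \<bullet> a e} \<le> 1"
  proof -
    \<comment> \<open>With zero shift the two normalised points coincide. The resulting equation
      forces \<open>r\<close> and \<open>r'\<close> to differ, as \<open>u\<close> is nonzero, and
      hence determines \<open>x e\<close>; two separated points cannot share it.\<close>
    have *: "(r - r') *\<^sub>R x e = r *\<^sub>R u" if "e \<in> G" "v \<bullet> a' e = v \<bullet> a e" for e
    proof -
      have "nrm (a' e - a e) \<le> 0" using on_arc_lipschitz[of "a' e" "a e"] arc that by simp
      then have "a' e = a e" using nrm_nonneg[of "a' e - a e"] nrm_eq_0[of "a' e - a e"] by simp
      then have "(r * r') *\<^sub>R a' e = (r * r') *\<^sub>R a e" by simp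
      then show ?thesis using pos by (simp add: a_def a'_def algebra_simps)
    qed
    have "e = f" if "e \<in> G" "v \<bullet> a' e = v \<bullet> a e" "f \<in> G" "v \<bullet> a' f = v \<bullet> a f" for e f
    proof (rule ccontr)
      assume "e \<noteq> f"
      have "r \<noteq> r'" using *[OF that(1,2)] pos by auto
      then have "x e = x f" using *[OF that(1,2)] *[OF that(3,4)]
        by (metis eq_iff_diff_eq_0 scaleR_cancel_left)
      then show False using close[OF that(1)] close[OF that(3)] sep[OF that(1,3) \<open>e \<noteq> f\<close>]
        by (simp add: a_def)
    qed
    then show ?thesis using fin by (simp add: card_le_Suc0_iff_eq)
  qed
  moreover have "G = {e\<in>G. v \<bullet> a e < v \<bullet> a' e} \<union> {e\<in>G. v \<bullet> a' e < v \<bullet> a e} \<union> {e\<in>G. v \<bullet> a' e = v \<bullet> a e}"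
    by auto
  then have "card G \<le> card {e\<in>G. v \<bullet> a e < v \<bullet> a' e} + card {e\<in>G. v \<bullet> a' e < v \<bullet> a e}
      + card {e\<in>G. v \<bullet> a' e = v \<bullet> a e}"
    by (metis (no_types, lifting) add_le_mono1 card_Un_le order_trans)
  ultimately show ?thesis by linarith
qed

text \<open>Pigeonhole: each \<open>e\<close> is sent to the pair of distances from its nearby point
  \<open>s e\<close> to \<open>P\<close> and \<open>Q\<close>. Both distances lie in
  \<open>T\<close>, and \<open>card_two_spheres_le\<close> allows five elements per pair.\<close>

lemma card_separated_le_square:
  assumes F: "finite F" "\<And>e. e \<in> F \<Longrightarrow> e extreme_point_of unit_ball nrm"
      "\<And>e. e \<in> F \<Longrightarrow> \<bar>v \<bullet> e\<bar> \<le> 1 / 4" "\<And>e. e \<in> F \<Longrightarrow> 0 < w \<bullet> e"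
    and sep: "\<And>e f. e \<in> F \<Longrightarrow> f \<in> F \<Longrightarrow> e \<noteq> f \<Longrightarrow> 2 * \<eta> < \<bar>v \<bullet> e - v \<bullet> f\<bar>"
    and M: "0 < M" "\<And>x. \<bar>v \<bullet> x\<bar> \<le> M * nrm x" "\<And>x. \<bar>w \<bullet> x\<bar> \<le> M * nrm x"
    and j: "0 < H" "H < j" "M * (2 * H / j) \<le> \<eta>" "\<eta> \<le> 1 / 4"
    and dense: "\<And>x. \<exists>y\<in>S. nrm (x - y) \<le> K"
    and PQ: "P \<in> S" "Q \<in> S" "P \<noteq> Q" "K + nrm (P - Q) \<le> H"
    and T: "finite T" "\<And>a b. a \<in> S \<Longrightarrow> b \<in> S \<Longrightarrow> \<bar>nrm (a - b) - j\<bar> \<le> H \<Longrightarrow> nrm (a - b) \<in> T"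
  shows "card F \<le> 5 * (card T)\<^sup>2"
proof -
  have "\<forall>e. \<exists>y. y \<in> S \<and> nrm ((P + j *\<^sub>R e) - y) \<le> K" using dense by blast
  then obtain s where s: "\<And>e. s e \<in> S" "\<And>e. nrm ((P + j *\<^sub>R e) - s e) \<le> K" by metis
  have nrm1: "nrm e = 1" if "e \<in> F" for e using extreme_point_nrm_eq_1 F that by blast
  have sP: "nrm ((s e - P) - j *\<^sub>R e) \<le> H" for e
  proof -
    have "(s e - P) - j *\<^sub>R e = - ((P + j *\<^sub>R e) - s e)" by simp
    then have "nrm ((s e - P) - j *\<^sub>R e) \<le> K" using s(2)[of e] by (metis nrm_minus)
    then show ?thesis using PQ nrm_nonneg[of "P - Q"] by linarith
  qed
  \<comment> \<open>Replacing \<open>P\<close> by \<open>Q\<close> costs \<open>nrm (P - Q)\<close>,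
    which \<open>H\<close> includes.\<close>
  have sQ: "nrm ((s e - Q) - j *\<^sub>R e) \<le> H" for e
  proof -
    have "(s e - Q) - j *\<^sub>R e = (P - Q) - ((P + j *\<^sub>R e) - s e)" by simp
    then have "nrm ((s e - Q) - j *\<^sub>R e) \<le> nrm (P - Q) + nrm ((P + j *\<^sub>R e) - s e)"
      using nrm_triangle_sub by metis
    then show ?thesis using PQ s(2)[of e] by linarith
  qed
  \<comment> \<open>Abscissae at most 1/4 leave room for a displacement \<eta> \<le> 1/4 within the
    arc. They also force a height of at least 3/4, so the height stays positive.\<close>
  have near: "y \<noteq> 0 \<and> \<bar>nrm y - j\<bar> \<le> H \<and> on_arc ((1 / nrm y) *\<^sub>R y) \<and>
      \<bar>v \<bullet> ((1 / nrm y) *\<^sub>R y) - v \<bullet> e\<bar> \<le> \<eta>"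
    if "e \<in> F" "nrm (y - j *\<^sub>R e) \<le> H" for e y
  proof -
    have ny: "\<bar>nrm y - j\<bar> \<le> H"
      using nrm_diff_bound[of y "j *\<^sub>R e"] that j nrm1 by simp
    then have "y \<noteq> 0" using j by auto
    define a where "a = (1 / nrm y) *\<^sub>R y"
    have "nrm (a - e) \<le> 2 * H / j"
      unfolding a_def using that j nrm1 \<open>y \<noteq> 0\<close> by (intro normalize_close) auto
    then have "M * nrm (a - e) \<le> \<eta>" using M j by (meson mult_left_mono order_less_imp_le order_trans)
    then have va: "\<bar>v \<bullet> a - v \<bullet> e\<bar> \<le> \<eta>" and wa: "\<bar>w \<bullet> a - w \<bullet> e\<bar> \<le> \<eta>"
      using M(2,3)[of "a - e"] by (auto simp: inner_diff_right)
    have "\<bar>w \<bullet> e\<bar> \<ge> 3/4" using nrm_le_coordinates[of e] nrm1 F(3) that by fastforce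
    then have "w \<bullet> a > 0" using wa F(4)[of e] that j by linarith
    moreover have "\<bar>v \<bullet> a\<bar> \<le> 1/2" using va F(3)[of e] that j by linarith
    moreover have "nrm a = 1" using \<open>y \<noteq> 0\<close> nrm_pos[of y] by (simp add: a_def)
    ultimately show ?thesis using ny \<open>y \<noteq> 0\<close> va by (auto simp: a_def on_arc_def)
  qed
  define g where "g e = (nrm (s e - P), nrm (s e - Q))" for e
  have gT: "g e \<in> T \<times> T" if "e \<in> F" for e
    using near[OF that sP] near[OF that sQ] T s PQ by (auto simp: g_def)
  have fiber: "card {e\<in>F. g e = t} \<le> 5" for t
  proof (cases "{e\<in>F. g e = t} = {}")
    case False
    then obtain e0 where e0: "e0 \<in> F" "g e0 = t" by blast
    obtain r r' where t: "t = (r, r')" by (cases t)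
    have sP_r: "nrm (s e - P) = r" and sQ_r: "nrm (s e - Q) = r'" if "g e = t" for e
      using that t by (auto simp: g_def)
    show ?thesis
    proof (rule card_two_spheres_le[of _ r "\<lambda>e. s e - P" r' "Q - P" \<eta>])
      fix e assume "e \<in> {e\<in>F. g e = t}"
      then have e: "e \<in> F" "g e = t" by auto
      have eq: "s e - P - (Q - P) = s e - Q" by simp
      show "e extreme_point_of unit_ball nrm" using F e by blast
      show "on_arc e" using F(3,4)[OF e(1)] nrm1[OF e(1)] by (simp add: on_arc_def)
      show "on_arc ((1 / r) *\<^sub>R (s e - P))" "\<bar>v \<bullet> ((1 / r) *\<^sub>R (s e - P)) - v \<bullet> e\<bar> \<le> \<eta>"
        using near[OF e(1) sP] sP_r[OF e(2)] by auto
      show "on_arc ((1 / r') *\<^sub>R (s e - P - (Q - P)))"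
        unfolding eq using near[OF e(1) sQ] sQ_r[OF e(2)] by auto
    next
      show "0 < r" "0 < r'"
        using near[OF e0(1) sP] near[OF e0(1) sQ] sP_r[OF e0(2)] sQ_r[OF e0(2)] nrm_pos by blast+
    qed (use F sep PQ in auto)
  next
    case True
    then show ?thesis by (metis card.empty zero_le)
  qed
  have "F = (\<Union>t\<in>T \<times> T. {e\<in>F. g e = t})" using gT by auto
  then have "card F \<le> (\<Sum>t\<in>T \<times> T. card {e\<in>F. g e = t})"
    using card_UN_le[of "T \<times> T" "\<lambda>t. {e\<in>F. g e = t}"] T by simp
  also have "\<dots> \<le> (\<Sum>t\<in>T \<times> T. 5)" using fiber by (intro sum_mono) auto
  also have "\<dots> = 5 * (card T)\<^sup>2" by (simp add: card_cartesian_product power2_eq_square)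
  finally show ?thesis .
qed

definition extreme_arc :: "(real ^ 2) set" where
  "extreme_arc = {e. e extreme_point_of unit_ball nrm \<and> \<bar>v \<bullet> e\<bar> \<le> 1 / 4 \<and> 0 < w \<bullet> e}"

text \<open>
  The radii \<open>N / 2 + 3 * H * k\<close> lie in \<open>[N / 2, N]\<close> and have disjoint \<open>H\<close>-neighbourhoods, each of
  which contains at least \<open>sqrt (card F / 5)\<close> distances.
\<close>

lemma card_separated_le:
  assumes S: "well_distributed nrm S"
  shows "\<exists>C>0. \<forall>\<^sub>F N in sequentially. finite (distance_set nrm N S) \<longrightarrow>
    (\<forall>F. finite F \<and> F \<subseteq> extreme_arc \<and>
      (\<forall>e\<in>F. \<forall>f\<in>F. e \<noteq> f \<longrightarrow> C / real N < \<bar>v \<bullet> e - v \<bullet> f\<bar>) \<longrightarrow>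
      real (card F) \<le> C * (real (card (distance_set nrm N S)) / real N)\<^sup>2)"
proof -
  obtain K where K: "\<And>x. \<exists>y\<in>S. nrm (x - y) \<le> K" using S by (auto simp: well_distributed_def)
  obtain P where P: "P \<in> S" using K by blast
  \<comment> \<open>The target is at distance \<open>K + 1\<close> from \<open>P\<close>, so a point
    of \<open>S\<close> within \<open>K\<close> of it differs from \<open>P\<close>.\<close>
  obtain Q where Q: "Q \<in> S" "nrm (P + (K + 1) *\<^sub>R p - Q) \<le> K" using K by blast
  have "0 \<le> K" using Q nrm_nonneg by (meson order_trans)
  then have "P \<noteq> Q" using Q nrm_p by auto
  define H where "H = K + nrm (P - Q)"
  have H: "0 < H" using \<open>0 \<le> K\<close> \<open>P \<noteq> Q\<close> nrm_pos[of "P - Q"] by (simp add: H_def)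
  obtain M where M: "0 < M" "\<And>x. \<bar>v \<bullet> x\<bar> \<le> M * nrm x" "\<And>x. \<bar>w \<bullet> x\<bar> \<le> M * nrm x"
    using coordinates_bounded by blast
  \<comment> \<open>The first summand makes \<open>C / N\<close> at least 2 \<eta>; the second is
    the constant of the final count.\<close>
  define C where "C = 8 * M * H + 5 * (24 * H)\<^sup>2"
  have C: "0 < C" "8 * M * H \<le> C" "5 * (24 * H)\<^sup>2 \<le> C" using H M by (auto simp: C_def add_pos_nonneg)
  have "real (card F) \<le> C * (real (card (distance_set nrm N S)) / real N)\<^sup>2"
    if N: "24 * H + 16 * M * H \<le> real N" and fin: "finite (distance_set nrm N S)"
      and F: "finite F" "F \<subseteq> extreme_arc"
      and sep: "\<And>e f. e \<in> F \<Longrightarrow> f \<in> F \<Longrightarrow> e \<noteq> f \<Longrightarrow> C / real N < \<bar>v \<bullet> e - v \<bullet> f\<bar>" for N F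
  proof -
    define D where "D = distance_set nrm N S"
    have MH: "0 < M * H" using M H by simp
    have N24: "24 * H \<le> real N" "16 * M * H \<le> real N" using N H MH by auto
    have N0: "0 < real N" using N24 H by linarith
    \<comment> \<open>This is the value of \<open>M * (2 * H / j)\<close> at the smallest radius
      \<open>N / 2\<close>.\<close>
    define \<eta> where "\<eta> = 4 * M * H / real N"
    \<comment> \<open>With this many radii the increments \<open>3 * H * k\<close> stay below
      \<open>N / 4\<close>, so every radius is at most \<open>3 / 4 * N\<close> and its
      \<open>H\<close>-neighbourhood stays below \<open>N\<close>.\<close>
    define n where "n = nat \<lfloor>real N / (12 * H)\<rfloor>"
    define j where "j k = real N / 2 + 3 * H * real k" for k :: nat
    define T where "T k = D \<inter> {j k - H..j k + H}" for k
    \<comment> \<open>For a quotient of at least 2, rounding down loses at most half, so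
      \<open>n\<close> is at least \<open>N / (24 * H)\<close>.\<close>
    have quot: "2 \<le> real N / (12 * H)" using N24 H by (simp add: field_simps)
    have n_le: "real n \<le> real N / (12 * H)" unfolding n_def using quot by (intro of_nat_floor) simp
    have "real N / (12 * H) - 1 \<le> real n" unfolding n_def using quot by linarith
    moreover have "x / 2 \<le> x - 1" if "2 \<le> x" for x :: real using that by simp
    from this[OF quot] have "real N / (12 * H) / 2 \<le> real N / (12 * H) - 1" .
    ultimately have n_ge: "real N / (24 * H) \<le> real n" by simp
    have cardT: "card F \<le> 5 * (card (T k))\<^sup>2" if k: "k < n" for k
    proof (rule card_separated_le_square[of F \<eta> M H "j k" S K P Q])
      have "3 * H * real k \<le> 3 * H * (real N / (12 * H))"
        using k n_le H by (intro mult_left_mono) auto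
      then have jk: "real N / 2 \<le> j k" "j k \<le> 3 / 4 * real N" using H by (auto simp: j_def)
      show "H < j k" using jk N24 H by linarith
      have "2 * H / j k \<le> 2 * H / (real N / 2)" using jk N0 H by (intro divide_left_mono) auto
      then have "M * (2 * H / j k) \<le> M * (2 * H / (real N / 2))" using M by (intro mult_left_mono) auto
      then show "M * (2 * H / j k) \<le> \<eta>" by (simp add: \<eta>_def algebra_simps)
      show "\<eta> \<le> 1 / 4" using N24 N0 by (simp add: \<eta>_def field_simps)
      have "2 * \<eta> \<le> C / real N" using C N0 by (simp add: \<eta>_def divide_right_mono)
      then show "2 * \<eta> < \<bar>v \<bullet> e - v \<bullet> f\<bar>" if "e \<in> F" "f \<in> F" "e \<noteq> f" for e f
        using sep[OF that] by linarith
      show "nrm (a - b) \<in> T k" if "a \<in> S" "b \<in> S" "\<bar>nrm (a - b) - j k\<bar> \<le> H" for a b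
      proof -
        have "nrm (a - b) \<le> real N" using that jk N24 H by linarith
        then show ?thesis using that by (auto simp: T_def D_def distance_set_def)
      qed
      show "finite (T k)" using fin by (simp add: T_def D_def)
    qed (use F H M K P Q \<open>P \<noteq> Q\<close> in \<open>auto simp: extreme_arc_def H_def\<close>)
    have disj: "T k \<inter> T l = {}" if "k \<noteq> l" for k l
    proof -
      have "1 \<le> \<bar>real k - real l\<bar>" using that by linarith
      then have "3 * H \<le> \<bar>3 * H * (real k - real l)\<bar>" using H by (simp add: abs_mult)
      moreover have "j k - j l = 3 * H * (real k - real l)" by (simp add: j_def algebra_simps)
      ultimately have "3 * H \<le> \<bar>j k - j l\<bar>" by simp
      then show ?thesis using H by (force simp: T_def)
    qed
    define \<tau> where "\<tau> = sqrt (real (card F) / 5)"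
    have \<tau>: "\<tau> \<le> real (card (T k))" if "k < n" for k
    proof -
      have "real (card F) \<le> real (5 * (card (T k))\<^sup>2)" using cardT[OF that] by (rule of_nat_mono)
      then have "real (card F) / 5 \<le> (real (card (T k)))\<^sup>2" by simp
      then show ?thesis unfolding \<tau>_def by (intro real_le_lsqrt) auto
    qed
    have "real n * \<tau> \<le> (\<Sum>k<n. real (card (T k)))"
      using sum_mono[of "{..<n}" "\<lambda>_. \<tau>" "\<lambda>k. real (card (T k))"] \<tau> by simp
    also have "\<dots> = real (card (\<Union>k<n. T k))"
      using disj fin by (subst card_UN_disjoint) (auto simp: T_def D_def)
    also have "\<dots> \<le> real (card D)"
      using fin by (intro of_nat_mono card_mono) (auto simp: T_def D_def)
    finally have "real n * \<tau> \<le> real (card D)" .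
    moreover have "0 \<le> \<tau>" by (simp add: \<tau>_def)
    ultimately have "real N / (24 * H) * \<tau> \<le> real (card D)"
      using mult_right_mono[OF n_ge] by (meson order_trans)
    then have "\<tau> \<le> 24 * H * (real (card D) / real N)" using N0 H by (simp add: field_simps)
    then have "\<tau>\<^sup>2 \<le> (24 * H * (real (card D) / real N))\<^sup>2" using \<open>0 \<le> \<tau>\<close> by (rule power_mono)
    then have "5 * \<tau>\<^sup>2 \<le> 5 * (24 * H * (real (card D) / real N))\<^sup>2" by simp
    also have "\<dots> = 5 * (24 * H)\<^sup>2 * (real (card D) / real N)\<^sup>2"
      by (simp only: power_mult_distrib mult.assoc)
    finally have "real (card F) \<le> 5 * (24 * H)\<^sup>2 * (real (card D) / real N)\<^sup>2"
      by (simp add: \<tau>_def)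
    also have "\<dots> \<le> C * (real (card D) / real N)\<^sup>2" using C by (intro mult_right_mono) auto
    finally show ?thesis by (simp add: D_def)
  qed
  moreover have "\<forall>\<^sub>F N in sequentially. 24 * H + 16 * M * H \<le> real N"
    using filterlim_real_sequentially by (simp add: filterlim_at_top)
  ultimately show ?thesis using C(1) by (intro exI[of _ C]) (auto elim!: eventually_mono)
qed

text \<open>For a separated set \<open>F\<close> of maximal size, every point of the arc has
  abscissa within \<open>C / N\<close> of one from \<open>F\<close>; otherwise it could be adjoined.
  The strips around \<open>F\<close> thus cover, and \<open>on_arc_lipschitz\<close> turns their
  width \<open>2 * C / N\<close> into diameter at most \<open>8 * C / N\<close>.\<close>

lemma extreme_arc_roughly_covered:
  assumes "well_distributed nrm S"
  shows "roughly_covered S extreme_arc"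
proof -
  obtain C where C: "C > 0" and ev: "\<forall>\<^sub>F N in sequentially. finite (distance_set nrm N S) \<longrightarrow>
    (\<forall>F. finite F \<and> F \<subseteq> extreme_arc \<and>
      (\<forall>e\<in>F. \<forall>f\<in>F. e \<noteq> f \<longrightarrow> C / real N < \<bar>v \<bullet> e - v \<bullet> f\<bar>) \<longrightarrow>
      real (card F) \<le> C * (real (card (distance_set nrm N S)) / real N)\<^sup>2)"
    using card_separated_le[OF assms] by blast
  have cover: "small_cover extreme_arc (8 * C / real N) (8 * C * (real (card (distance_set nrm N S)) / real N)\<^sup>2)"
    if bound: "\<forall>F. finite F \<and> F \<subseteq> extreme_arc \<and>
      (\<forall>e\<in>F. \<forall>f\<in>F. e \<noteq> f \<longrightarrow> C / real N < \<bar>v \<bullet> e - v \<bullet> f\<bar>) \<longrightarrow>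
      real (card F) \<le> C * (real (card (distance_set nrm N S)) / real N)\<^sup>2" for N
  proof -
    define m where "m = C * (real (card (distance_set nrm N S)) / real N)\<^sup>2"
    define sep where "sep F \<longleftrightarrow> finite F \<and> F \<subseteq> extreme_arc \<and>
      (\<forall>e\<in>F. \<forall>f\<in>F. e \<noteq> f \<longrightarrow> C / real N < \<bar>v \<bullet> e - v \<bullet> f\<bar>)" for F
    have le_m: "real (card F) \<le> m" if "sep F" for F using bound[rule_format, of F] that by (simp add: sep_def m_def)
    \<comment> \<open>A maximum exists because all cardinalities are bounded by
      \<open>m\<close>.\<close>
    have "\<exists>F. sep F \<and> (\<forall>G. sep G \<longrightarrow> card G \<le> card F)"
    proof (rule ex_has_greatest_nat[of sep "{}" card "nat \<lfloor>m\<rfloor> + 1"])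
      show "sep {}" by (simp add: sep_def)
      have "card F < nat \<lfloor>m\<rfloor> + 1" if "sep F" for F
        using le_nat_floor[OF le_m[OF that]] by simp
      then show "\<forall>F. sep F \<longrightarrow> card F < nat \<lfloor>m\<rfloor> + 1" by blast
    qed
    then obtain F where F: "sep F" "\<And>G. sep G \<Longrightarrow> card G \<le> card F" by blast
    define U where "U e = {x \<in> extreme_arc. \<bar>v \<bullet> x - v \<bullet> e\<bar> \<le> C / real N}" for e
    have cov: "\<exists>e\<in>F. x \<in> U e" if x: "x \<in> extreme_arc" for x
    proof (rule ccontr)
      assume no: "\<not> ?thesis"
      have "x \<in> U x" using x C by (simp add: U_def)
      then have "x \<notin> F" using no by blast
      have far: "C / real N < \<bar>v \<bullet> x - v \<bullet> e\<bar>" if "e \<in> F" for e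
      proof -
        have "x \<notin> U e" using no that by blast
        then show ?thesis using x by (simp add: U_def)
      qed
      have "sep (insert x F)"
        using F(1) far x by (simp add: sep_def abs_minus_commute)
      then have "card (insert x F) \<le> card F" by (rule F(2))
      then show False using F(1) \<open>x \<notin> F\<close> by (simp add: sep_def)
    qed
    have small: "nrm (x - y) \<le> 8 * C / real N" if "x \<in> U e" "y \<in> U e" for x y e
    proof -
      have "on_arc x" "on_arc y"
        using that extreme_point_nrm_eq_1 by (auto simp: U_def extreme_arc_def on_arc_def)
      then have le: "nrm (x - y) \<le> 4 * \<bar>v \<bullet> x - v \<bullet> y\<bar>" by (rule on_arc_lipschitz)
      have "\<bar>v \<bullet> x - v \<bullet> y\<bar> \<le> \<bar>v \<bullet> x - v \<bullet> e\<bar> + \<bar>v \<bullet> y - v \<bullet> e\<bar>"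
        using abs_triangle_ineq4[of "v \<bullet> x - v \<bullet> e" "v \<bullet> y - v \<bullet> e"] by simp
      also have "\<dots> \<le> C / real N + C / real N"
        using that by (intro add_mono) (simp_all add: U_def)
      finally have "4 * \<bar>v \<bullet> x - v \<bullet> y\<bar> \<le> 4 * (C / real N + C / real N)"
        by (rule mult_left_mono) simp
      with le have "nrm (x - y) \<le> 4 * (C / real N + C / real N)" by (rule order_trans)
      then show ?thesis by simp
    qed
    have "real (card (U ` F)) \<le> card F" using F(1) card_image_le[of F U] by (simp add: sep_def)
    also have "\<dots> \<le> m" using F(1) by (rule le_m)
    also have "\<dots> \<le> 8 * C * (real (card (distance_set nrm N S)) / real N)\<^sup>2"
      using C by (simp add: m_def)
    finally have "real (card (U ` F)) \<le> 8 * C * (real (card (distance_set nrm N S)) / real N)\<^sup>2" .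
    moreover have "finite (U ` F)" using F(1) by (simp add: sep_def)
    moreover have "extreme_arc \<subseteq> \<Union>(U ` F)" using cov by blast
    moreover have "\<forall>V\<in>U ` F. \<forall>x\<in>V. \<forall>y\<in>V. nrm (x - y) \<le> 8 * C / real N" using small by blast
    ultimately show ?thesis unfolding small_cover_def by blast
  qed
  from ev have "\<forall>\<^sub>F N in sequentially. finite (distance_set nrm N S) \<longrightarrow>
      small_cover extreme_arc (8 * C / real N) (8 * C * (real (card (distance_set nrm N S)) / real N)\<^sup>2)"
  proof (rule eventually_mono, intro impI cover)
    fix N assume "finite (distance_set nrm N S) \<longrightarrow> (\<forall>F. finite F \<and> F \<subseteq> extreme_arc \<and>
        (\<forall>e\<in>F. \<forall>f\<in>F. e \<noteq> f \<longrightarrow> C / real N < \<bar>v \<bullet> e - v \<bullet> f\<bar>) \<longrightarrow>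
        real (card F) \<le> C * (real (card (distance_set nrm N S)) / real N)\<^sup>2)"
      and "finite (distance_set nrm N S)"
    then show "\<forall>F. finite F \<and> F \<subseteq> extreme_arc \<and>
        (\<forall>e\<in>F. \<forall>f\<in>F. e \<noteq> f \<longrightarrow> C / real N < \<bar>v \<bullet> e - v \<bullet> f\<bar>) \<longrightarrow>
        real (card F) \<le> C * (real (card (distance_set nrm N S)) / real N)\<^sup>2" by (rule mp)
  qed
  then show ?thesis unfolding roughly_covered_def using C by (intro exI[of _ "8 * C"]) simp
qed

end

section \<open>From arcs to the whole unit sphere\<close>

context planar_norm
begin

text \<open>Rotating \<open>p\<close> by a right angle gives \<open>q0\<close>, orthogonal to
  \<open>p\<close> and of the same Euclidean length. Hence suitable multiples of \<open>q0\<close>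
  and \<open>p\<close> serve both as the basis \<open>(q, p)\<close> and as its dual basis
  \<open>(v, w)\<close>.\<close>

lemma frame_exists:
  assumes "nrm p = 1"
  obtains q v w where "planar_frame nrm p q v w" "v \<bullet> p = 0" "0 < w \<bullet> p"
proof -
  define q0 :: "real^2" where "q0 = vector [- p $ 2, p $ 1]"
  have p: "p \<noteq> 0" using assms by auto
  have sq: "(p $ 1)\<^sup>2 + (p $ 2)\<^sup>2 \<noteq> 0"
    using p by (auto simp: vec_eq_iff forall_2 sum_power2_eq_zero_iff)
  then have "q0 \<noteq> 0" by (auto simp: q0_def vec_eq_iff forall_2)
  define l where "l = nrm q0"
  have l: "l > 0" using \<open>q0 \<noteq> 0\<close> nrm_pos by (simp add: l_def)
  define d where "d = (p $ 1)\<^sup>2 + (p $ 2)\<^sup>2"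
  define q where "q = (1 / l) *\<^sub>R q0"
  define v where "v = (l / d) *\<^sub>R q0"
  define w where "w = (1 / d) *\<^sub>R p"
  have d: "d > 0" using sq by (simp add: d_def order_less_le)
  have "x = (v \<bullet> x) *\<^sub>R q + (w \<bullet> x) *\<^sub>R p" for x
  proof -
    have "(v \<bullet> x) *\<^sub>R q + (w \<bullet> x) *\<^sub>R p = (1 / d) *\<^sub>R ((q0 \<bullet> x) *\<^sub>R q0 + (p \<bullet> x) *\<^sub>R p)"
      using l by (simp add: v_def w_def q_def scaleR_add_right)
    also have "(q0 \<bullet> x) *\<^sub>R q0 + (p \<bullet> x) *\<^sub>R p = d *\<^sub>R x"
      by (simp add: vec_eq_iff forall_2 q0_def inner_vec_def sum_2 d_def power2_eq_square algebra_simps)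
    finally show ?thesis using d by simp
  qed
  then have "planar_frame nrm p q v w"
    using assms l by unfold_locales (auto simp: q_def l_def)
  moreover have "v \<bullet> p = 0" by (simp add: v_def q0_def inner_vec_def sum_2)
  moreover have "0 < w \<bullet> p" using p d by (simp add: w_def)
  ultimately show ?thesis using that by blast
qed

text \<open>Each point \<open>p\<close> of the unit sphere has an open neighbourhood whose extreme
  points lie in the arc of a frame at \<open>p\<close>. By compactness finitely many of these
  suffice.\<close>

lemma extreme_points_roughly_covered:
  assumes S: "well_distributed nrm S"
  shows "roughly_covered S {x. x extreme_point_of unit_ball nrm}" (is "roughly_covered S ?E")
proof -
  have "\<exists>W. open W \<and> p \<in> W \<and> roughly_covered S (?E \<inter> W)" if "nrm p = 1" for p
  proof -
    obtain q v w where "planar_frame nrm p q v w" and p: "v \<bullet> p = 0" "0 < w \<bullet> p"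
      using frame_exists[OF \<open>nrm p = 1\<close>] .
    then interpret planar_frame nrm p q v w by simp
    let ?W = "{x. v \<bullet> x < 1 / 4} \<inter> {x. - v \<bullet> x < 1 / 4} \<inter> {x. 0 < w \<bullet> x}"
    have "open ?W" using open_halfspace_gt[of 0 w] by (intro open_Int open_halfspace_lt) auto
    moreover have "p \<in> ?W" using p by simp
    moreover have "roughly_covered S (?E \<inter> ?W)"
      by (rule roughly_covered_subset[OF extreme_arc_roughly_covered[OF S]]) (auto simp: extreme_arc_def)
    ultimately show ?thesis by blast
  qed
  then have "\<forall>p\<in>{x. nrm x = 1}. \<exists>W. open W \<and> p \<in> W \<and> roughly_covered S (?E \<inter> W)" by blast
  from bchoice[OF this] obtain W
    where W: "\<forall>p\<in>{x. nrm x = 1}. open (W p) \<and> p \<in> W p \<and> roughly_covered S (?E \<inter> W p)" ..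
  have "{x. nrm x = 1} \<subseteq> (\<Union>p\<in>{x. nrm x = 1}. W p)" using W by blast
  then obtain I where I: "I \<subseteq> {x. nrm x = 1}" "finite I" "{x. nrm x = 1} \<subseteq> (\<Union>p\<in>I. W p)"
    by (rule compactE_image[OF compact_unit_sphere, rotated]) (use W in blast)+
  have "roughly_covered S (\<Union>p\<in>I. ?E \<inter> W p)"
    using I(2,1)
  proof (induction I rule: finite_induct)
    case (insert p I)
    then show ?case using W by (simp add: roughly_covered_Un)
  qed (simp add: roughly_covered_empty)
  moreover have "?E \<subseteq> {x. nrm x = 1}" using extreme_point_nrm_eq_1 by blast
  then have "?E \<subseteq> (\<Union>p\<in>I. ?E \<inter> W p)" using I(3) by blast
  ultimately show ?thesis by (rule roughly_covered_subset)
qed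

section \<open>From covers to Hausdorff measure\<close>

lemma hausdorff_content_le:
  assumes "small_cover A \<eta> m" "0 \<le> \<eta>" "\<eta> \<le> \<delta>" "0 < s"
  shows "hausdorff_content (\<lambda>x y. nrm (x - y)) s \<delta> A \<le> ennreal (m * \<eta> powr s)"
proof -
  let ?d = "\<lambda>x y. nrm (x - y)"
  obtain \<U> where \<U>: "finite \<U>" "real (card \<U>) \<le> m" "A \<subseteq> \<Union>\<U>"
    "\<And>U x y. U \<in> \<U> \<Longrightarrow> x \<in> U \<Longrightarrow> y \<in> U \<Longrightarrow> nrm (x - y) \<le> \<eta>"
    using assms(1) unfolding small_cover_def by blast
  obtain h where h: "bij_betw h {0..<card \<U>} \<U>" using ex_bij_betw_nat_finite[OF \<U>(1)] by blast
  \<comment> \<open>The finite cover is padded to a sequence by empty sets, whose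
    \<open>diam_pow\<close> is 0.\<close>
  define V where "V i = (if i < card \<U> then h i else {})" for i
  have hU: "h i \<in> \<U>" if "i < card \<U>" for i using h that by (auto simp: bij_betw_def)
  have ediam: "ediam ?d (V i) \<le> ennreal \<eta>" for i
    unfolding ediam_def V_def using hU \<U>(4) by (auto intro!: SUP_least ennreal_leI)
  have pow: "diam_pow ?d s (V i) \<le> ennreal (\<eta> powr s)" for i
  proof -
    have "enn2real (ediam ?d (V i)) \<le> \<eta>" using ediam assms(2) by (intro enn2real_leI) auto
    then show ?thesis using assms by (auto simp: diam_pow_def intro!: ennreal_leI powr_mono2)
  qed
  have "(\<Union>i. V i) = \<Union>\<U>" using h by (auto simp: V_def bij_betw_def split: if_splits) (metis atLeastLessThan_iff imageE)
  then have "V \<in> {U. A \<subseteq> (\<Union>n. U n) \<and> (\<forall>n. ediam ?d (U n) \<le> ennreal \<delta>)}"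
    using \<U>(3) order_trans[OF ediam ennreal_leI[OF assms(3)]] by auto
  then have "hausdorff_content ?d s \<delta> A \<le> (\<Sum>i. diam_pow ?d s (V i))"
    unfolding hausdorff_content_def by (rule INF_lower)
  also have "\<dots> = (\<Sum>i<card \<U>. diam_pow ?d s (V i))"
    by (rule suminf_finite) (auto simp: V_def diam_pow_def)
  also have "\<dots> \<le> (\<Sum>i<card \<U>. ennreal (\<eta> powr s))" by (intro sum_mono pow)
  also have "\<dots> = ennreal (real (card \<U>) * \<eta> powr s)"
    by (simp add: ennreal_mult ennreal_of_nat_eq_real_of_nat)
  also have "\<dots> \<le> ennreal (m * \<eta> powr s)" using \<U>(2) by (intro ennreal_leI mult_right_mono) auto
  finally show ?thesis .
qed

text \<open>Covers chosen for the smaller of \<delta> and \<epsilon> are admissible at scale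
  \<delta> and have sum at most \<epsilon>, so every content vanishes.\<close>

lemma hausdorff_measure_eq_0I:
  assumes "0 < s"
    and "\<And>\<epsilon>. 0 < \<epsilon> \<Longrightarrow> \<exists>\<eta> m. 0 \<le> \<eta> \<and> \<eta> \<le> \<epsilon> \<and> small_cover A \<eta> m \<and> m * \<eta> powr s \<le> \<epsilon>"
  shows "hausdorff_measure (\<lambda>x y. nrm (x - y)) s A = 0"
proof -
  have "hausdorff_content (\<lambda>x y. nrm (x - y)) s \<delta> A \<le> 0" if "0 < \<delta>" for \<delta>
  proof (rule ennreal_le_epsilon)
    fix \<epsilon> :: real assume "0 < \<epsilon>"
    then obtain \<eta> m where "0 \<le> \<eta>" "\<eta> \<le> min \<delta> \<epsilon>" "small_cover A \<eta> m" "m * \<eta> powr s \<le> min \<delta> \<epsilon>"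
      using assms(2)[of "min \<delta> \<epsilon>"] \<open>0 < \<delta>\<close> by auto
    then show "hausdorff_content (\<lambda>x y. nrm (x - y)) s \<delta> A \<le> 0 + ennreal \<epsilon>"
      using hausdorff_content_le[of A \<eta> m \<delta> s] assms(1) by (auto intro: order_trans ennreal_leI)
  qed
  then show ?thesis unfolding hausdorff_measure_def by (intro antisym SUP_least) auto
qed

text \<open>A cover by about \<open>(card D / N)^2\<close> sets of diameter of order
  \<open>1 / N\<close> has \<open>s\<close>-sum of order
  \<open>(card D / N)^2 * N powr (- s)\<close>, where \<open>D\<close> is the distance set. Such
  covers exist for all large \<open>N\<close>, so smallness for infinitely many \<open>N\<close> is
  enough.\<close>

lemma extreme_points_hausdorff_measure_0:
  assumes S: "well_distributed nrm S" and s: "0 < s"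
    and freq: "\<And>\<epsilon>. 0 < \<epsilon> \<Longrightarrow> \<exists>\<^sub>F N in sequentially. finite (distance_set nrm N S) \<and>
      (real (card (distance_set nrm N S)) / real N)\<^sup>2 * real N powr (- s) < \<epsilon>"
  shows "hausdorff_measure (\<lambda>x y. nrm (x - y)) s {x. x extreme_point_of unit_ball nrm} = 0"
proof (rule hausdorff_measure_eq_0I[OF s])
  fix \<epsilon> :: real assume \<epsilon>: "0 < \<epsilon>"
  let ?E = "{x. x extreme_point_of unit_ball nrm}"
  let ?c = "\<lambda>N. (real (card (distance_set nrm N S)) / real N)\<^sup>2"
  obtain C where C: "0 < C" and cov: "\<forall>\<^sub>F N in sequentially. finite (distance_set nrm N S) \<longrightarrow>
      small_cover ?E (C / real N) (C * ?c N)"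
    using extreme_points_roughly_covered[OF S] unfolding roughly_covered_def by blast
  \<comment> \<open>The divisor collects the constants from the number of sets and from their
    diameters.\<close>
  define \<epsilon>' where "\<epsilon>' = \<epsilon> / (C * C powr s)"
  have "0 < \<epsilon>'" using C \<epsilon> by (simp add: \<epsilon>'_def)
  have "\<forall>\<^sub>F N in sequentially. max 1 (C / \<epsilon>) \<le> real N"
    using filterlim_real_sequentially by (simp add: filterlim_at_top del: max.bounded_iff)
  from frequently_ex[OF frequently_eventually_conj[OF freq[OF \<open>0 < \<epsilon>'\<close>] eventually_conj[OF cov this]]]
  obtain N where N: "finite (distance_set nrm N S)" "?c N * real N powr (- s) < \<epsilon>'"
      "small_cover ?E (C / real N) (C * ?c N)" "1 \<le> real N" "C / \<epsilon> \<le> real N"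
    by auto
  have "C / real N \<le> \<epsilon>" using N \<epsilon> C by (simp add: field_simps)
  moreover have "(C * ?c N) * (C / real N) powr s \<le> \<epsilon>"
  proof -
    have "(C * ?c N) * (C / real N) powr s = (C * C powr s) * (?c N * real N powr (- s))"
    proof -
      have "(C / real N) powr s = C powr s * real N powr (- s)"
        using C N(4) by (simp add: powr_divide powr_minus_divide)
      then show ?thesis by simp
    qed
    also have "\<dots> \<le> (C * C powr s) * \<epsilon>'" using N C by (intro mult_left_mono) auto
    also have "\<dots> = \<epsilon>" using C by (simp add: \<epsilon>'_def)
    finally show ?thesis .
  qed
  ultimately show "\<exists>\<eta> m. 0 \<le> \<eta> \<and> \<eta> \<le> \<epsilon> \<and> small_cover ?E \<eta> m \<and> m * \<eta> powr s \<le> \<epsilon>"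
    using N C by (intro exI[of _ "C / real N"] exI[of _ "C * ?c N"]) auto
qed

end

section \<open>The measure and dimension bounds\<close>

theorem theorem1:
  fixes nrm :: "real ^ 2 \<Rightarrow> real" and S :: "(real ^ 2) set"
  assumes "is_norm nrm"
    and "well_distributed nrm S"
    and "liminf (\<lambda>N. emeasure (count_space UNIV) (distance_set nrm N S)
                       * ennreal (real N powr (- 3 / 2))) = 0"
  shows "hausdorff_measure (\<lambda>x y. nrm (x - y)) 1
           {x. x extreme_point_of unit_ball nrm} = 0 \<and>
         (\<forall>\<alpha>::real. 0 < \<alpha> \<and> \<alpha> < 1 / 2 \<and>
           (\<exists>C::real. \<forall>\<^sub>F N in sequentially.
             emeasure (count_space UNIV) (distance_set nrm N S)
               \<le> ennreal (C * real N powr (1 + \<alpha>)))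
          \<longrightarrow> hausdorff_dim (\<lambda>x y. nrm (x - y))
               {x. x extreme_point_of unit_ball nrm} \<le> ereal (2 * \<alpha>))"
proof -
  interpret planar_norm nrm by unfold_locales (rule assms(1))
  let ?E = "{x. x extreme_point_of unit_ball nrm}"
  let ?D = "\<lambda>N. distance_set nrm N S"
  \<comment> \<open>At \<open>N = 0\<close> the \<open>powr\<close> factor is 0 and would annihilate
    an infinite cardinality.\<close>
  have ev_pos: "\<forall>\<^sub>F N in sequentially. 0 < N" by (rule eventually_gt_at_top)
  have measure_0: "hausdorff_measure (\<lambda>x y. nrm (x - y)) 1 ?E = 0"
  proof (rule extreme_points_hausdorff_measure_0[OF assms(2)])
    fix \<epsilon> :: real assume \<epsilon>: "0 < \<epsilon>"
    let ?f = "\<lambda>N. emeasure (count_space UNIV) (?D N) * ennreal (real N powr (- 3 / 2))"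
    \<comment> \<open>Squaring this bound gives the required one for \<open>s = 1\<close>, since
      \<open>N powr (- 3)\<close> is \<open>N powr (- 1)\<close> divided by the square of
      \<open>N\<close>.\<close>
    have "\<exists>\<^sub>F N in sequentially. ?f N < ennreal (sqrt \<epsilon>)"
    proof (rule ccontr)
      assume "\<not> ?thesis"
      then have "\<forall>\<^sub>F N in sequentially. ennreal (sqrt \<epsilon>) \<le> ?f N"
        by (simp add: not_frequently not_less)
      then have "ennreal (sqrt \<epsilon>) \<le> liminf ?f" by (rule Liminf_bounded)
      then show False using assms(3) \<epsilon> by simp
    qed
    from frequently_eventually_conj[OF this ev_pos]
    show "\<exists>\<^sub>F N in sequentially. finite (?D N) \<and>
      (real (card (?D N)) / real N)\<^sup>2 * real N powr (- 1) < \<epsilon>"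
    proof (rule frequently_elim1)
      fix N assume N: "0 < N \<and> ?f N < ennreal (sqrt \<epsilon>)"
      have fin: "finite (?D N)"
      proof (rule ccontr)
        assume "infinite (?D N)"
        then have "?f N = \<infinity>" using N by (simp add: emeasure_count_space_infinite ennreal_top_mult)
        then show False using N by simp
      qed
      then have "?f N = ennreal (real (card (?D N)) * real N powr (- 3 / 2))"
        by (simp add: emeasure_count_space_finite ennreal_mult ennreal_of_nat_eq_real_of_nat)
      then have "real (card (?D N)) * real N powr (- 3 / 2) < sqrt \<epsilon>"
        using N by (simp add: ennreal_less_iff)
      then have "(real (card (?D N)) * real N powr (- 3 / 2))\<^sup>2 < (sqrt \<epsilon>)\<^sup>2"
        by (intro power_strict_mono) auto
      moreover have "(real N powr (- 3 / 2))\<^sup>2 = real N powr (- 3)"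
        using powr_add[of "real N" "- 3 / 2" "- 3 / 2"] by (simp add: power2_eq_square)
      moreover have "real N powr (- 3) = real N powr (- 1) / (real N)\<^sup>2"
        using N powr_diff[of "real N" "- 1" 2] by simp
      moreover have "(sqrt \<epsilon>)\<^sup>2 = \<epsilon>" using \<epsilon> by simp
      ultimately have "(real (card (?D N)))\<^sup>2 * (real N powr (- 1) / (real N)\<^sup>2) < \<epsilon>"
        by (simp only: power_mult_distrib)
      then show "finite (?D N) \<and> (real (card (?D N)) / real N)\<^sup>2 * real N powr (- 1) < \<epsilon>"
        using fin by (simp add: power_divide mult.commute)
    qed
  qed simp
  have "hausdorff_dim (\<lambda>x y. nrm (x - y)) ?E \<le> ereal (2 * \<alpha>)"
    if \<alpha>: "0 < \<alpha>" and C: "\<forall>\<^sub>F N in sequentially.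
      emeasure (count_space UNIV) (?D N) \<le> ennreal (C * real N powr (1 + \<alpha>))" for \<alpha> C :: real
  proof (rule ereal_le_epsilon2)
    fix \<gamma> :: real assume \<gamma>: "0 < \<gamma>"
    \<comment> \<open>With this exponent the quantity to be made small is at most a constant times
      \<open>N powr (- \<gamma>)\<close>.\<close>
    define s where "s = 2 * \<alpha> + \<gamma>"
    have s: "0 < s" using \<alpha> \<gamma> by (simp add: s_def)
    have "hausdorff_measure (\<lambda>x y. nrm (x - y)) s ?E = 0"
    proof (rule extreme_points_hausdorff_measure_0[OF assms(2) s])
      fix \<epsilon> :: real assume \<epsilon>: "0 < \<epsilon>"
      have "(\<lambda>N. \<bar>C\<bar>\<^sup>2 * real N powr (- \<gamma>)) \<longlonglongrightarrow> \<bar>C\<bar>\<^sup>2 * 0"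
        using \<gamma> by (intro tendsto_mult tendsto_const tendsto_neg_powr filterlim_real_sequentially) auto
      then have "\<forall>\<^sub>F N in sequentially. \<bar>C\<bar>\<^sup>2 * real N powr (- \<gamma>) < \<epsilon>"
        using \<epsilon> by (intro order_tendstoD) auto
      with C ev_pos have "\<forall>\<^sub>F N in sequentially. finite (?D N) \<and>
          (real (card (?D N)) / real N)\<^sup>2 * real N powr (- s) < \<epsilon>"
      proof eventually_elim
        case (elim N)
        have fin: "finite (?D N)"
        proof (rule ccontr)
          assume "infinite (?D N)"
          then show False using elim by (simp add: emeasure_count_space_infinite top_unique)
        qed
        then have "ennreal (real (card (?D N))) \<le> ennreal (C * real N powr (1 + \<alpha>))"
          using elim(1) by (simp add: emeasure_count_space_finite ennreal_of_nat_eq_real_of_nat)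
        \<comment> \<open>\<open>ennreal\<close> truncates negative reals to 0; a nonnegative bound
          lets the comparison pass to the reals.\<close>
        also have "\<dots> \<le> ennreal (\<bar>C\<bar> * real N powr (1 + \<alpha>))"
          by (intro ennreal_leI mult_right_mono) auto
        finally have "ennreal (real (card (?D N))) \<le> ennreal (\<bar>C\<bar> * real N powr (1 + \<alpha>))" .
        then have "real (card (?D N)) \<le> \<bar>C\<bar> * real N powr (1 + \<alpha>)" by simp
        also have "real N powr (1 + \<alpha>) = real N powr \<alpha> * real N" using elim(2) by (simp add: powr_add)
        finally have "real (card (?D N)) / real N \<le> \<bar>C\<bar> * real N powr \<alpha>"
          using elim(2) by (simp add: divide_le_eq)
        then have "(real (card (?D N)) / real N)\<^sup>2 \<le> (\<bar>C\<bar> * real N powr \<alpha>)\<^sup>2"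
          by (intro power_mono) auto
        then have "(real (card (?D N)) / real N)\<^sup>2 * real N powr (- s)
            \<le> (\<bar>C\<bar> * real N powr \<alpha>)\<^sup>2 * real N powr (- s)"
          by (rule mult_right_mono) simp
        moreover have "(real N powr \<alpha>)\<^sup>2 * real N powr (- s) = real N powr (- \<gamma>)"
          using powr_add[of "real N" \<alpha> \<alpha>] powr_add[of "real N" "\<alpha> + \<alpha>" "- s"]
          by (simp add: s_def power2_eq_square)
        then have "(\<bar>C\<bar> * real N powr \<alpha>)\<^sup>2 * real N powr (- s) = \<bar>C\<bar>\<^sup>2 * real N powr (- \<gamma>)"
          by (simp only: power_mult_distrib mult.assoc)
        ultimately have "(real (card (?D N)) / real N)\<^sup>2 * real N powr (- s)
            \<le> \<bar>C\<bar>\<^sup>2 * real N powr (- \<gamma>)" by (rule ord_le_eq_trans)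
        then have "(real (card (?D N)) / real N)\<^sup>2 * real N powr (- s) < \<epsilon>"
          using elim(3) by (rule order.strict_trans1)
        with fin show ?case by (rule conjI)
      qed
      then show "\<exists>\<^sub>F N in sequentially. finite (?D N) \<and>
          (real (card (?D N)) / real N)\<^sup>2 * real N powr (- s) < \<epsilon>"
        by (rule eventually_frequently[rotated]) simp
    qed
    then have "hausdorff_dim (\<lambda>x y. nrm (x - y)) ?E \<le> ereal s"
      unfolding hausdorff_dim_def using s by (intro INF_lower) auto
    then show "hausdorff_dim (\<lambda>x y. nrm (x - y)) ?E \<le> ereal (2 * \<alpha>) + ereal \<gamma>"
      by (simp add: s_def)
  qed
  then show ?thesis using measure_0 by (metis (no_types, lifting))
qed

end
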